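(* Let $h \geq 3$ be an integer and let $A = \{a_1, \ldots, a_{h+1}\}$ be a set of positive integers with $a_1 < \cdots < a_{h+1}$. Then \[|h^{\wedge}_{\pm}A| \geq h^2 + 2h + 1.\] This lower bound is best possible: for every $h \geq 3$ there is a set $A$ of $h+1$ positive integers with $|h^{\wedge}_{\pm}A| = h^2 + 2h + 1$.
   Context: For a finite set $A = \{a_1, \ldots, a_k\}$ of integers (with distinct $a_i$) and a positive integer $h$, the restricted $h$-fold signed sumset is \[h^{\wedge}_{\pm}A = \left\{ \sum_{i=1}^{k} \lambda_i a_i : \lambda_i \in \{-1,0,1\}, \ \sum_{i=1}^{k} |\lambda_i| = h \right\}.\] *)

theory Defs
  imports Main
begin

definition restricted_signed_sumset :: "nat \<Rightarrow> int set \<Rightarrow> int set" where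
  "restricted_signed_sumset h A =
     {(\<Sum>a\<in>A. l a * a) | l :: int \<Rightarrow> int.
        (\<forall>a\<in>A. l a \<in> {-1, 0, 1}) \<and> (\<Sum>a\<in>A. \<bar>l a\<bar>) = int h}"

end

theory Submission
  imports Defs "HOL-Library.FuncSet"
begin

text \<open>
  Let \<open>A = {a\<^sub>1 < \<dots> < a\<^sub>n}\<close> with \<open>n = h + 1\<close>. Up to translation by the sum of \<open>A\<close>, a signed sum omits
  one element \<open>a\<close> and counts the remaining ones with weight 0 or 2. Removing the largest element \<open>a\<^sub>n\<close>
  and reflecting, the induction from \<open>(n - 1)\<^sup>2\<close> to \<open>n\<^sup>2\<close> needs \<open>2n - 1\<close> such sums below \<open>2a\<^sub>n + a\<^sub>1\<close>. The
  elements of \<open>A\<close> provide \<open>n\<close> of them; the other \<open>n - 1\<close> are sums \<open>a\<^sub>i + 2a\<^sub>j\<close> in \<open>[a\<^sub>n + 2a\<^sub>1, 2a\<^sub>n + a\<^sub>1)\<close>.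

  Translating \<open>a\<^sub>1\<close> to 0 and halving, the latter concerns a set \<open>B\<close> with minimum 0, maximum \<open>M\<close> and an
  odd element. For odd \<open>M\<close>, the sums \<open>M + 2y\<close> and \<open>0 + 2y\<close> differ in parity and give one value for each
  \<open>y \<noteq> M\<close>. For \<open>M = 2c\<close> they collide exactly when both \<open>x\<close> and \<open>x - c\<close> lie in \<open>B\<close>; an odd \<open>b \<in> B\<close>
  then gives a new odd sum \<open>b + 2x\<close> or \<open>b + 2(x - c)\<close> for each collision, unless the summand is \<open>b\<close> itself.
  The loss of this one sum is always recovered elsewhere, except when \<open>B = {0, c, 2c}\<close>. For \<open>A\<close> this leaves
  only the triples \<open>{a, 3a, 5a}\<close>, where the bound indeed fails, and their four-element extensions
  are treated by hand.
\<close>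

section \<open>Sums \<open>x + 2 * y\<close> in a half-open window\<close>

definition pair_sums :: "int \<Rightarrow> int set \<Rightarrow> int set" where
  "pair_sums M B = {s. \<exists>x\<in>B. \<exists>y\<in>B. x \<noteq> y \<and> s = x + 2 * y \<and> M \<le> s \<and> s < 2 * M}"

lemma finite_pair_sums: "finite (pair_sums M B)"
  by (rule finite_subset[of _ "{M..2*M}"]) (auto simp: pair_sums_def)

lemma pair_sumsI:
  "x \<in> B \<Longrightarrow> y \<in> B \<Longrightarrow> x \<noteq> y \<Longrightarrow> M \<le> x + 2 * y \<Longrightarrow> x + 2 * y < 2 * M \<Longrightarrow> x + 2 * y \<in> pair_sums M B"
  by (auto simp: pair_sums_def)

text \<open>
  The hypotheses describe a set that attains one pair sum too few: \<open>b\<close> is its only odd element, and no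
  even pair sum is new. If \<open>b = c \<plusminus> 2r\<close>, halving the element nearest to \<open>4r\<close> (from 0, respectively
  from \<open>2c\<close>) and adding \<open>b\<close> forces an element into the gap around \<open>b\<close>.
\<close>
lemma no_single_odd_element:
  fixes B :: "int set" and b c :: int
  assumes fin: "finite B" and sub: "B \<subseteq> {0..2*c}" and z: "0 \<in> B" and m: "2 * c \<in> B"
    and codd: "odd c" and c0: "c > 0" and bodd: "odd b" and bB: "b \<in> B"
    and b1: "2 * c \<le> 3 * b" and b2: "3 * b < 4 * c"
    and mate: "(if c \<le> b then b - c else b + c) \<in> B"
    and ev: "\<And>y. y \<in> B \<Longrightarrow> y \<noteq> b \<Longrightarrow> even y"
    and hole: "\<And>y. y \<in> B \<Longrightarrow> 2 * c \<le> b + 2 * y \<Longrightarrow> b + 2 * y < 4 * c \<Longrightarrow> y = b"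
    and closed: "\<And>e x. 2 * e \<in> B \<Longrightarrow> x \<in> B \<Longrightarrow> 2 * e \<noteq> x \<Longrightarrow> c \<le> e + x \<Longrightarrow> e + x < 2 * c
        \<Longrightarrow> e + x \<in> B \<or> e + x - c \<in> B"
    and notAP: "B \<noteq> {0, c, 2 * c}"
  shows False
proof -
  consider "b = c" | "b > c" | "b < c" by linarith
  then show False
  proof cases
    case 1
    then obtain u where u: "u \<in> B" "u \<noteq> 0" "u \<noteq> c" "u \<noteq> 2 * c"
      using notAP z m bB by blast
    have far: "2 * y < c \<or> 3 * c \<le> 2 * y" if "y \<in> B" "y \<noteq> c" for y
      using hole[of y] that 1 by linarith
    have nonneg: "0 \<le> y" "y \<le> 2 * c" if "y \<in> B" for y using that sub by auto
    show False
    proof (cases "\<exists>y\<in>B. 0 < y \<and> 2 * y < c")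
      case True
      define Y where "Y = {y\<in>B. 0 < y \<and> 2 * y < c}"
      have fY: "finite Y" "Y \<noteq> {}" using fin True by (auto simp: Y_def)
      define y where "y = Min Y"
      have y: "y \<in> B" "0 < y" "2 * y < c" using Min_in[OF fY] by (auto simp: Y_def y_def)
      have ymin: "y \<le> t" if "t \<in> B" "0 < t" "2 * t < c" for t
        using Min_le[OF fY(1), of t] that by (auto simp: Y_def y_def)
      have "even y" using ev[of y] y 1 c0 by auto
      then obtain e where e: "y = 2 * e" by auto
      \<comment> \<open>\<open>e + c\<close> falls into the gap described by \<open>far\<close>, and
        \<open>e\<close> undercuts the minimal \<open>y\<close>.\<close>
      have "e + c \<in> B \<or> e + c - c \<in> B"
        by (rule closed) (use y e bB 1 in auto)
      then show False using far[of "e + c"] ymin[of e] y e by auto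
    next
      case False
      define Y where "Y = {y\<in>B. 3 * c \<le> 2 * y \<and> y < 2 * c}"
      have "u \<in> Y" using far[of u] u nonneg[of u] False by (force simp: Y_def)
      then have fY: "finite Y" "Y \<noteq> {}" using fin by (auto simp: Y_def)
      define y where "y = Max Y"
      have y: "y \<in> B" "3 * c \<le> 2 * y" "y < 2 * c" using Max_in[OF fY] by (auto simp: Y_def y_def)
      have ymax: "t \<le> y" if "t \<in> B" "3 * c \<le> 2 * t" "t < 2 * c" for t
        using Max_ge[OF fY(1), of t] that by (auto simp: Y_def y_def)
      have "even y" using ev[of y] y 1 c0 by auto
      then obtain e where e: "y = 2 * e" by auto
      \<comment> \<open>Now \<open>e\<close> falls into the gap, and \<open>e + c\<close> exceeds
        the maximal \<open>y\<close>.\<close>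
      have "e + c \<in> B \<or> e + c - c \<in> B"
        by (rule closed) (use y e bB 1 c0 in auto)
      then show False using far[of "e"] ymax[of "e + c"] y e c0 by auto
    qed
  next
    case 2
    have "even (b - c)" using codd bodd by simp
    then obtain r where r: "b = c + 2 * r" by (metis add.commute diff_add_cancel evenE)
    have r0: "0 < r" "6 * r < c" using 2 b2 r by auto
    have mr: "2 * r \<in> B" using mate 2 r by simp
    define Y where "Y = {y\<in>B. y < 4 * r}"
    have fY: "finite Y" "Y \<noteq> {}" using fin mr r0 by (auto simp: Y_def)
    \<comment> \<open>Since \<open>r \<le> e < 2 * r\<close> for the half \<open>e\<close> of
      \<open>F\<close>, the number \<open>e + b - c = e + 2 * r\<close> lies strictly between
      \<open>F\<close> and \<open>4 * r\<close>, which the choice of \<open>F\<close>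
      forbids.\<close>
    define F where "F = Max Y"
    have F: "F \<in> B" "F < 4 * r" using Max_in[OF fY] by (auto simp: Y_def F_def)
    have Fmax: "t \<le> F" if "t \<in> B" "t < 4 * r" for t
      using Max_ge[OF fY(1), of t] that by (auto simp: Y_def F_def)
    have F2: "2 * r \<le> F" using Fmax[OF mr] r0 by simp
    have "F \<noteq> b" using F r r0 by auto
    then have "even F" using ev F by auto
    then obtain e where e: "F = 2 * e" by auto
    have "e + b \<in> B \<or> e + b - c \<in> B"
      by (rule closed) (use F e F2 bB \<open>F \<noteq> b\<close> r r0 in auto)
    moreover have "e + b - c \<notin> B" using Fmax[of "e + b - c"] F e r r0 by auto
    ultimately have G: "e + b \<in> B" by simp
    have G1: "4 * c \<le> b + 2 * (e + b)"
    proof (rule ccontr)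
      assume "\<not> ?thesis"
      then have "e + b = b" by (intro hole[OF G]) (use r r0 e F2 in auto)
      then show False using e F2 r0 by simp
    qed
    \<comment> \<open>In this second use of \<open>closed\<close> the first alternative would be an
      odd element larger than \<open>b\<close>.\<close>
    have "e + (e + b) \<in> B \<or> e + (e + b) - c \<in> B"
      by (rule closed) (use F G e F2 r r0 in auto)
    moreover have "e + (e + b) \<notin> B" using ev[of "e + (e + b)"] bodd e F2 r0 by auto
    ultimately have H: "2 * e + 2 * r \<in> B" using r by (simp add: algebra_simps)
    \<comment> \<open>\<open>G1\<close> gives \<open>c \<le> 6 * r + 2 * e\<close>, which puts
      \<open>2 * e + 2 * r\<close> into the range where \<open>hole\<close> admits only
      \<open>b\<close>.\<close>
    show False using hole[OF H] r r0 e F F2 G1 by auto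
  next
    case 3
    have "even (c - b)" using codd bodd by simp
    then obtain r where r': "c - b = 2 * r" by (rule evenE)
    then have r: "b = c - 2 * r" by simp
    have r0: "0 < r" "6 * r \<le> c" using 3 b1 r by auto
    have mr: "2 * c - 2 * r \<in> B" using mate 3 r by simp
    define Y where "Y = {y\<in>B. 2 * c - 4 * r < y}"
    have fY: "finite Y" "Y \<noteq> {}" using fin mr r0 by (auto simp: Y_def)
    \<comment> \<open>Mirror image of the previous case: here \<open>e + b\<close> would lie
      strictly between \<open>2 * c - 4 * r\<close> and \<open>F\<close>.\<close>
    define F where "F = Min Y"
    have F: "F \<in> B" "2 * c - 4 * r < F" using Min_in[OF fY] by (auto simp: Y_def F_def)
    have Fmin: "F \<le> t" if "t \<in> B" "2 * c - 4 * r < t" for t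
      using Min_le[OF fY(1), of t] that by (auto simp: Y_def F_def)
    have F2: "F \<le> 2 * c - 2 * r" using Fmin[OF mr] r0 by simp
    have "F \<noteq> b" using F r r0 by auto
    then have "even F" using ev F by auto
    then obtain e where e: "F = 2 * e" by auto
    have "e + b \<in> B \<or> e + b - c \<in> B"
      by (rule closed) (use F e F2 bB \<open>F \<noteq> b\<close> r r0 in auto)
    moreover have "e + b \<notin> B" using Fmin[of "e + b"] F e r r0 by auto
    ultimately have G: "e + b - c \<in> B" by simp
    have G1: "b + 2 * (e + b - c) < 2 * c"
    proof (rule ccontr)
      assume "\<not> ?thesis"
      then have "e + b - c = b" by (intro hole[OF G]) (use r r0 e F2 in auto)
      then show False using e F2 r0 by simp
    qed
    have "e + (e + b - c) \<in> B \<or> e + (e + b - c) - c \<in> B"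
      by (rule closed) (use F G e F2 r r0 in auto)
    moreover have "e + (e + b - c) - c \<notin> B"
      using ev[of "e + (e + b - c) - c"] bodd e F2 r0 r by auto
    ultimately have H: "2 * e - 2 * r \<in> B" using r by (simp add: algebra_simps)
    show False using hole[OF H] r r0 e F F2 G1 by auto
  qed
qed

text \<open>\<open>U\<close> consists of the halves of the even sums with single summand 0 or
  \<open>2 * c\<close>, and \<open>P\<close> of their collisions, so
  \<open>card B = card U + card P + 1\<close>. A counterexample thus has
  \<open>card Od < card P\<close>, whereas every odd \<open>b\<close> gives
  \<open>card (W b - {b}) \<le> card Od\<close> and \<open>card P \<le> card (W b)\<close>. Every
  estimate is then tight, which leads to the configuration of
  \<open>no_single_odd_element\<close>.\<close>

lemma card_pair_sums_even_max:
  fixes B :: "int set" and b c :: int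
  assumes fin: "finite B" and sub: "B \<subseteq> {0..2*c}" and z: "0 \<in> B" and m: "2 * c \<in> B"
    and c0: "c > 0" and b0: "b \<in> B" "odd b" and notAP: "B \<noteq> {0, c, 2 * c}"
  shows "card B \<le> card (pair_sums (2 * c) B) + 1"
proof (rule ccontr)
  assume "\<not> ?thesis"
  then have small: "card (pair_sums (2 * c) B) + 1 < card B" by simp
  define Q where "Q = pair_sums (2 * c) B"
  define Lo where "Lo = {y\<in>B. y < c}"
  define Hi where "Hi = {y\<in>B. c \<le> y \<and> y < 2 * c}"
  define U where "U = Hi \<union> (\<lambda>y. y + c) ` Lo"
  define P where "P = Hi \<inter> (\<lambda>y. y + c) ` Lo"
  define E where "E = {v. c \<le> v \<and> v < 2 * c \<and> 2 * v \<in> Q}"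
  define Od where "Od = {v\<in>Q. odd v}"
  define D where "D = {y\<in>B. odd y}"
  \<comment> \<open>\<open>W b\<close> selects a half-open interval of length \<open>c\<close>, so it contains exactly one of \<open>x\<close> and \<open>x - c\<close>,
    namely \<open>rep b x\<close>.\<close>
  define W where "W = (\<lambda>b. {y\<in>B. 2 * c \<le> b + 2 * y \<and> b + 2 * y < 4 * c})"
  define rep where "rep = (\<lambda>b x. if 4 * c \<le> b + 2 * x then x - c else x)"
  have bnd: "0 \<le> y" "y \<le> 2 * c" if "y \<in> B" for y using that sub by auto
  have fins: "finite Q" "finite Lo" "finite Hi" "finite U" "finite P" "finite Od" "finite D" "\<And>b. finite (W b)"
    using fin by (auto simp: Q_def finite_pair_sums Lo_def Hi_def U_def P_def Od_def D_def W_def)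
  have finE: "finite E" by (rule finite_subset[of _ "{c..2*c}"]) (auto simp: E_def)
  have Bsplit: "B = insert (2 * c) (Lo \<union> Hi)"
    using m bnd by (force simp: Lo_def Hi_def)
  have "2 * c \<notin> Lo \<union> Hi" "Lo \<inter> Hi = {}" using c0 by (auto simp: Lo_def Hi_def)
  then have cB: "card B = Suc (card Lo + card Hi)"
    by (subst Bsplit) (simp add: fins card_Un_disjoint)
  have "card ((\<lambda>y. y + c) ` Lo) = card Lo" by (rule card_image) (simp add: inj_on_def)
  then have cU: "card U + card P = card Hi + card Lo"
    using card_Un_Int[of Hi "(\<lambda>y. y + c) ` Lo"] fins by (simp add: U_def P_def)
  have UE: "U \<subseteq> E"
  proof
    fix v assume "v \<in> U"
    then consider "v \<in> Hi" | y where "y \<in> Lo" "v = y + c" by (auto simp: U_def)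
    then show "v \<in> E"
    proof cases
      case 1
      then show ?thesis using pair_sumsI[of 0 B v "2 * c"] z c0 by (auto simp: E_def Q_def Hi_def)
    next
      case 2
      then show ?thesis using pair_sumsI[of "2 * c" B y "2 * c"] m c0 bnd[of y]
        by (auto simp: E_def Q_def Lo_def algebra_simps)
    qed
  qed
  have EQ: "card E + card Od \<le> card Q"
  proof -
    have "card ((\<lambda>v. 2 * v) ` E) = card E" by (rule card_image) (simp add: inj_on_def)
    moreover have "card ((\<lambda>v. 2 * v) ` E \<union> Od) = card ((\<lambda>v. 2 * v) ` E) + card Od"
      by (rule card_Un_disjoint) (use finE fins in \<open>auto simp: Od_def\<close>)
    moreover have "card ((\<lambda>v. 2 * v) ` E \<union> Od) \<le> card Q"
      by (rule card_mono) (use fins in \<open>auto simp: E_def Od_def\<close>)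
    ultimately show ?thesis by simp
  qed
  have Ucard: "card U \<le> card E" using UE finE by (rule card_mono[rotated])
  have OdP: "card Od < card P" using small cB cU EQ Ucard by (simp add: Q_def)
  have inj2: "card ((\<lambda>y. b + 2 * y) ` S) = card S" for b :: int and S
    by (rule card_image) (simp add: inj_on_def)
  have sumOd: "(\<lambda>y. b + 2 * y) ` (W b - {b}) \<subseteq> Od" if "b \<in> D" for b
  proof
    fix s assume "s \<in> (\<lambda>y. b + 2 * y) ` (W b - {b})"
    then obtain y where "y \<in> W b" "y \<noteq> b" "s = b + 2 * y" by auto
    then show "s \<in> Od" using that pair_sumsI[of b B y "2 * c"] by (auto simp: W_def Od_def D_def Q_def)
  qed
  have WOd: "card (W b - {b}) \<le> card Od" if "b \<in> D" for b
    using card_mono[OF fins(6) sumOd[OF that]] inj2 by simp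
  have Pm: "x \<in> B" "x - c \<in> B" "c \<le> x" "x < 2 * c" if "x \<in> P" for x
    using that by (auto simp: P_def Hi_def Lo_def)
  have repW: "rep b ` P \<subseteq> W b" if "b \<in> D" for b
  proof
    fix y assume "y \<in> rep b ` P"
    then obtain x where x: "x \<in> P" "y = rep b x" by auto
    have "0 \<le> b" "b \<le> 2 * c" using that bnd by (auto simp: D_def)
    then show "y \<in> W b" using Pm[OF x(1)] x(2) by (auto simp: rep_def W_def split: if_splits)
  qed
  have repinj: "card (rep b ` P) = card P" for b
    by (rule card_image) (use Pm in \<open>force simp: inj_on_def rep_def split: if_splits\<close>)
  have brep: "b \<in> rep b ` P" if "b \<in> D" for b
  proof (rule ccontr)
    assume "b \<notin> rep b ` P"
    then have "rep b ` P \<subseteq> W b - {b}" using repW[OF that] by blast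
    then have "card P \<le> card (W b - {b})" using repinj card_mono[of "W b - {b}"] fins by (metis finite_Diff)
    then show False using WOd[OF that] OdP by simp
  qed
  have bW: "b \<in> W b" if "b \<in> D" for b using brep repW that by blast
  have mid: "2 * c \<le> 3 * b" "3 * b < 4 * c" if "b \<in> D" for b
    using bW[OF that] by (auto simp: W_def)
  have mate: "(if c \<le> b then b - c else b + c) \<in> B" if "b \<in> D" for b
  proof -
    have "b \<in> rep b ` P" using that by (rule brep)
    then obtain x where x: "x \<in> P" "b = rep b x" by blast
    then show ?thesis using Pm[OF x(1)] by (auto simp: rep_def split: if_splits)
  qed
  have cW: "card (W b) = card P" "card Od + 1 = card P" if "b \<in> D" for b
  proof -
    have "card (W b) = card (W b - {b}) + 1" using bW[OF that] fins(8)
      by (metis Suc_eq_plus1 card.remove)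
    moreover have "card P \<le> card (W b)" using repinj[of b] card_mono[OF fins(8) repW[OF that]] by simp
    ultimately show "card (W b) = card P" "card Od + 1 = card P" using WOd[OF that] OdP by auto
  qed
  have b0D: "b \<in> D" using b0 by (simp add: D_def)
  have "card U = card E" using small cB cU EQ Ucard cW(2)[OF b0D] by (simp add: Q_def)
  then have EU: "E = U" using UE finE by (metis card_subset_eq)
  \<comment> \<open>For even \<open>c\<close> the mate of \<open>b\<close> is odd as well, so by
    \<open>mid\<close> both lie in an interval of length \<open>2 * c / 3\<close>, although they
    differ by \<open>c\<close>.\<close>
  have codd: "odd c"
  proof
    assume "even c"
    then have "(if c \<le> b then b - c else b + c) \<in> D"
      using mate[OF b0D] b0 by (auto simp: D_def)
    from mid[OF this] mid[OF b0D] show False by (auto split: if_splits)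
  qed
  have DW: "W b = D" if "b \<in> D" for b
  proof -
    have "D \<subseteq> W b"
    proof
      fix y assume y: "y \<in> D"
      show "y \<in> W b" using mid[OF y] mid[OF that] y by (simp add: W_def D_def)
    qed
    \<comment> \<open>For odd \<open>c\<close> exactly one of \<open>x\<close> and
      \<open>x - c\<close> is odd.\<close>
    moreover have "card P \<le> card D"
    proof (rule card_inj_on_le[of "\<lambda>x. if odd x then x else x - c"])
      show "inj_on (\<lambda>x. if odd x then x else x - c) P"
        using Pm by (force simp: inj_on_def)
      show "(\<lambda>x. if odd x then x else x - c) ` P \<subseteq> D"
        using Pm codd by (auto simp: D_def)
    qed (rule fins)
    ultimately show ?thesis using card_seteq[OF fins(8), of D b] cW(1)[OF that] by simp
  qed
  have Odeq: "(\<lambda>y. b + 2 * y) ` (D - {b}) = Od" if "b \<in> D" for b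
  proof (rule card_subset_eq[OF fins(6)])
    show "(\<lambda>y. b + 2 * y) ` (D - {b}) \<subseteq> Od" using sumOd[OF that] DW[OF that] by simp
    show "card ((\<lambda>y. b + 2 * y) ` (D - {b})) = card Od"
      using inj2 cW[OF that] DW[OF that] card.remove[OF fins(7) that] by simp
  qed
  have single: "D = {b}"
  proof (rule ccontr)
    assume ne: "D \<noteq> {b}"
    define p where "p = Min D"
    have p: "p \<in> D" using Min_in[OF fins(7)] b0D by (auto simp: p_def)
    have f2: "finite (D - {p})" "D - {p} \<noteq> {}" using ne b0D fins by auto
    define s where "s = Min (D - {p})"
    have s: "s \<in> D" "s \<noteq> p" using Min_in[OF f2] by (auto simp: s_def)
    have ps: "p < s" using Min_le[OF fins(7) s(1)] s(2) by (simp add: p_def)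
    \<comment> \<open>\<open>Odeq\<close> describes the same set \<open>Od\<close> for every odd
      \<open>b\<close>. Reading \<open>s + 2 * p\<close> with single summand \<open>p\<close> makes
      the midpoint of the two smallest odd elements an odd element of \<open>B\<close>.\<close>
    have "s + 2 * p \<in> Od" using Odeq[OF s(1)] p s by auto
    then have "s + 2 * p \<in> (\<lambda>y. p + 2 * y) ` (D - {p})" using Odeq[OF p] by simp
    then obtain t where t: "t \<in> D" "t \<noteq> p" "s + 2 * p = p + 2 * t" by blast
    then have "s \<le> t" using Min_le[OF f2(1), of t] by (simp add: s_def)
    then show False using t ps by simp
  qed
  show False
  proof (rule no_single_odd_element[OF fin sub z m codd c0 b0(2) b0(1) mid[OF b0D] mate[OF b0D] _ _ _ notAP])
    show "even y" if "y \<in> B" "y \<noteq> b" for y using single that by (auto simp: D_def)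
    show "y = b" if "y \<in> B" "2 * c \<le> b + 2 * y" "b + 2 * y < 4 * c" for y
      using DW[OF b0D] single that by (auto simp: W_def)
    show "e + x \<in> B \<or> e + x - c \<in> B"
      if "2 * e \<in> B" "x \<in> B" "2 * e \<noteq> x" "c \<le> e + x" "e + x < 2 * c" for e x
    proof -
      have "2 * (e + x) \<in> Q" using pair_sumsI[of "2 * e" B x "2 * c"] that by (auto simp: Q_def algebra_simps)
      then have "e + x \<in> U" using that EU by (auto simp: E_def)
      then show ?thesis by (auto simp: U_def Hi_def Lo_def)
    qed
  qed
qed

lemma card_pair_sums_odd_max:
  fixes B :: "int set"
  assumes fin: "finite B" and sub: "B \<subseteq> {0..M}" and z: "0 \<in> B" and m: "M \<in> B" and M: "odd M"
  shows "card B \<le> card (pair_sums M B) + 1"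
proof -
  \<comment> \<open>For \<open>0 \<le> y < M\<close> exactly one of \<open>M + 2 * y\<close> and
    \<open>2 * y\<close> lies in the window; \<open>Lo\<close> and \<open>Hi\<close> record
    which.\<close>
  define Lo where "Lo = {y\<in>B. 2 * y < M}"
  define Hi where "Hi = {y\<in>B. M \<le> 2 * y \<and> y < M}"
  have M0: "0 < M" using M m sub by (cases "M = 0") auto
  have bnd: "0 \<le> y" "y \<le> M" if "y \<in> B" for y using that sub by auto
  have fins: "finite Lo" "finite Hi" using fin by (auto simp: Lo_def Hi_def)
  have Bsplit: "B = insert M (Lo \<union> Hi)" using m bnd by (force simp: Lo_def Hi_def)
  have "M \<notin> Lo \<union> Hi" "Lo \<inter> Hi = {}" using M0 by (auto simp: Lo_def Hi_def)
  then have cB: "card B = Suc (card Lo + card Hi)"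
    by (subst Bsplit) (simp add: fins card_Un_disjoint)
  have "card ((\<lambda>y. M + 2 * y) ` Lo) = card Lo" "card ((\<lambda>y. 2 * y) ` Hi) = card Hi"
    by (auto intro!: card_image simp: inj_on_def)
  moreover have "(\<lambda>y. M + 2 * y) ` Lo \<inter> (\<lambda>y. 2 * y) ` Hi = {}" using M by auto presburger
  ultimately have "card Lo + card Hi = card ((\<lambda>y. M + 2 * y) ` Lo \<union> (\<lambda>y. 2 * y) ` Hi)"
    using fins by (simp add: card_Un_disjoint)
  also have "\<dots> \<le> card (pair_sums M B)"
  proof (rule card_mono[OF finite_pair_sums], rule Un_least)
    show "(\<lambda>y. M + 2 * y) ` Lo \<subseteq> pair_sums M B"
      using m bnd M0 by (auto simp: Lo_def intro!: pair_sumsI)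
    show "(\<lambda>y. 2 * y) ` Hi \<subseteq> pair_sums M B"
      using pair_sumsI[of 0 B _ M] z M0 by (auto simp: Hi_def)
  qed
  finally show ?thesis using cB by simp
qed

text \<open>Descent on \<open>M\<close>: if all elements are even, \<open>B\<close> is halved, and
  doubling embeds the pair sums of the half. Excluding \<open>{0, c, 2 * c}\<close> for all
  \<open>c\<close> makes the hypothesis invariant under this scaling.\<close>

lemma card_pair_sums_ge:
  fixes B :: "int set"
  assumes "finite B" "B \<subseteq> {0..M}" "0 \<in> B" "M \<in> B" "0 < M" "\<And>c. B \<noteq> {0, c, 2 * c}"
  shows "card B \<le> card (pair_sums M B) + 1"
  using assms
proof (induction "nat M" arbitrary: M B rule: less_induct)
  case less
  show ?case
  proof (cases "\<exists>b\<in>B. odd b")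
    case True
    then obtain b where b: "b \<in> B" "odd b" by blast
    show ?thesis
    proof (cases "odd M")
      case True
      then show ?thesis using card_pair_sums_odd_max less.prems by blast
    next
      case False
      then obtain c where "M = 2 * c" by auto
      then show ?thesis using card_pair_sums_even_max[of B c b] b less.prems by auto
    qed
  next
    case False
    define C where "C = {y. 2 * y \<in> B}"
    have BC: "B = (\<lambda>y. 2 * y) ` C" using False by (fastforce simp: C_def elim: evenE)
    obtain c where c: "M = 2 * c" using less.prems False by blast
    have inj: "inj_on (\<lambda>y. 2 * y) S" for S :: "int set" by (simp add: inj_on_def)
    have "card C \<le> card (pair_sums c C) + 1"
    proof (rule less.hyps)
      show "nat c < nat M" "0 < c" using less.prems c by auto
      show "finite C" using less.prems(1) BC inj finite_imageD by blast
      show "C \<subseteq> {0..c}" "0 \<in> C" "c \<in> C" using less.prems c by (auto simp: C_def)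
      show "C \<noteq> {0, d, 2 * d}" for d using less.prems(6)[of "2 * d"] BC by auto
    qed
    moreover have "card C = card B" using BC card_image[OF inj] by metis
    moreover have "card (pair_sums c C) \<le> card (pair_sums M B)"
    proof (rule card_inj_on_le[OF inj _ finite_pair_sums])
      show "(\<lambda>y. 2 * y) ` pair_sums c C \<subseteq> pair_sums M B"
      proof
        fix s assume "s \<in> (\<lambda>y. 2 * y) ` pair_sums c C"
        then obtain x y where "x \<in> C" "y \<in> C" "x \<noteq> y" "s = 2 * (x + 2 * y)" "c \<le> x + 2 * y" "x + 2 * y < 2 * c"
          by (auto simp: pair_sums_def)
        then show "s \<in> pair_sums M B"
          using pair_sumsI[of "2 * x" B "2 * y" M] by (auto simp: C_def c algebra_simps)
      qed
    qed
    ultimately show ?thesis by simp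
  qed
qed

section \<open>Punctured sums and the induction increment\<close>

text \<open>These are the signed sums with coefficient 0 at \<open>a\<close>, 1 on \<open>T\<close>
  and -1 elsewhere, translated by \<open>\<Sum>A\<close>.\<close>

definition punctured_sums :: "int set \<Rightarrow> int set" where
  "punctured_sums A = {a + 2 * \<Sum>T | a T. a \<in> A \<and> T \<subseteq> A - {a}}"

lemma finite_punctured_sums: "finite A \<Longrightarrow> finite (punctured_sums A)"
  by (rule finite_subset[of _ "(\<lambda>(a, T). a + 2 * \<Sum>T) ` (A \<times> Pow A)"])
    (auto simp: punctured_sums_def)

lemma punctured_sums_mono: "A \<subseteq> B \<Longrightarrow> punctured_sums A \<subseteq> punctured_sums B"
  unfolding punctured_sums_def by blast

lemma punctured_sumsI: "a \<in> A \<Longrightarrow> T \<subseteq> A - {a} \<Longrightarrow> s = a + 2 * \<Sum>T \<Longrightarrow> s \<in> punctured_sums A"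
  unfolding punctured_sums_def by blast

lemma punctured_sums_single: "a \<in> A \<Longrightarrow> a \<in> punctured_sums A"
  by (rule punctured_sumsI[of a _ "{}"]) auto

lemma punctured_sums_pair: "a \<in> A \<Longrightarrow> x \<in> A \<Longrightarrow> a \<noteq> x \<Longrightarrow> a + 2 * x \<in> punctured_sums A"
  by (rule punctured_sumsI[of a _ "{x}"]) auto

lemma punctured_sums_triple:
  "a \<in> A \<Longrightarrow> x \<in> A \<Longrightarrow> y \<in> A \<Longrightarrow> a \<noteq> x \<Longrightarrow> a \<noteq> y \<Longrightarrow> x \<noteq> y \<Longrightarrow> a + 2 * (x + y) \<in> punctured_sums A"
  by (rule punctured_sumsI[of a _ "{x, y}"]) auto

lemma punctured_sums_le:
  assumes fin: "finite A" and min: "\<And>y. y \<in> A \<Longrightarrow> a \<le> y" and a: "0 \<le> a" and x: "x \<in> punctured_sums A"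
  shows "x \<le> 2 * \<Sum>A - a"
proof -
  obtain i T where i: "i \<in> A" "T \<subseteq> A - {i}" "x = i + 2 * \<Sum>T"
    using x by (auto simp: punctured_sums_def)
  have "\<Sum>T \<le> \<Sum>(A - {i})"
    by (rule sum_mono2) (use i fin min a in force)+
  also have "\<dots> = \<Sum>A - i" using fin i by (simp add: sum_diff1)
  finally show ?thesis using i min[of i] by simp
qed

text \<open>Complementing \<open>T\<close> within \<open>A - {i}\<close> corresponds to negating the
  signed sum.\<close>

lemma punctured_sums_reflect:
  assumes fin: "finite A" and x: "x \<in> punctured_sums A"
  shows "2 * \<Sum>A - x \<in> punctured_sums A"
proof -
  obtain i T where i: "i \<in> A" "T \<subseteq> A - {i}" "x = i + 2 * \<Sum>T"
    using x by (auto simp: punctured_sums_def)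
  have "\<Sum>(A - {i} - T) = \<Sum>(A - {i}) - \<Sum>T" using fin i finite_subset by (intro sum_diff) auto
  also have "\<dots> = \<Sum>A - i - \<Sum>T" using fin i by (simp add: sum_diff1)
  finally show ?thesis by (intro punctured_sumsI[of i _ "A - {i} - T"]) (use i in auto)
qed

text \<open>Reflection sends sums below \<open>2 * z + a\<close> above
  \<open>2 * \<Sum>A - a\<close>, which bounds all punctured sums of \<open>A\<close>.\<close>

lemma card_punctured_sums_insert_max:
  assumes fin: "finite A" and min: "\<And>y. y \<in> A \<Longrightarrow> a \<le> y" and a: "0 \<le> a"
    and z: "\<And>y. y \<in> A \<Longrightarrow> y < z"
  shows "card (punctured_sums A) + card {x \<in> punctured_sums (insert z A). x < 2 * z + a}
    \<le> card (punctured_sums (insert z A))" (is "_ + card ?L \<le> _")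
proof -
  let ?r = "\<lambda>x. 2 * \<Sum>(insert z A) - x"
  have zA: "z \<notin> A" using z by blast
  have finY: "finite (punctured_sums A)" "finite ?L" "finite (punctured_sums (insert z A))"
    using fin by (auto intro!: finite_punctured_sums)
  have "card (?r ` ?L) = card ?L" by (rule card_image) (simp add: inj_on_def)
  moreover have "punctured_sums A \<inter> ?r ` ?L = {}"
    using punctured_sums_le[OF fin min a] fin zA by force
  ultimately have "card (punctured_sums A) + card ?L = card (punctured_sums A \<union> ?r ` ?L)"
    using finY by (simp add: card_Un_disjoint)
  also have "\<dots> \<le> card (punctured_sums (insert z A))"
  proof (rule card_mono[OF finY(3)], rule Un_least)
    show "punctured_sums A \<subseteq> punctured_sums (insert z A)" by (rule punctured_sums_mono) auto
    show "?r ` ?L \<subseteq> punctured_sums (insert z A)"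
      using punctured_sums_reflect[of "insert z A"] fin by blast
  qed
  finally show ?thesis .
qed

text \<open>The elements of \<open>A\<close> are at most \<open>z\<close>. Translating
  \<open>B\<close> back by \<open>a\<close> adds \<open>3 * a\<close> to each pair sum and moves the
  window to \<open>[z + 2 * a, 2 * z + a)\<close>, so the two families are disjoint.\<close>

lemma card_low_punctured_sums:
  assumes fin: "finite A" and sub: "A \<subseteq> {a..z}" and aA: "a \<in> A" and zA: "z \<in> A"
    and a: "0 < a" and az: "a < z" and notAP: "\<And>g. A \<noteq> {a, a + g, a + 2 * g}"
  shows "2 * card A \<le> card {x \<in> punctured_sums A. x < 2 * z + a} + 1" (is "_ \<le> card ?L + 1")
proof -
  define B where "B = (\<lambda>x. x - a) ` A"
  let ?P = "(\<lambda>s. s + 3 * a) ` pair_sums (z - a) B"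
  have AB: "A = (\<lambda>x. a + x) ` B" by (force simp: B_def image_image)
  have "card B = card A" unfolding B_def by (rule card_image) (simp add: inj_on_def)
  moreover have "card B \<le> card (pair_sums (z - a) B) + 1"
  proof (rule card_pair_sums_ge)
    show "finite B" "B \<subseteq> {0..z - a}" "0 \<in> B" "z - a \<in> B" "0 < z - a"
      using fin sub aA zA az by (auto simp: B_def)
    show "B \<noteq> {0, c, 2 * c}" for c using notAP[of c] AB by auto
  qed
  moreover have "card ?P = card (pair_sums (z - a) B)" by (rule card_image) (simp add: inj_on_def)
  moreover have "A \<inter> ?P = {}" using sub a by (force simp: pair_sums_def)
  then have "card (A \<union> ?P) = card A + card ?P"
    using fin finite_pair_sums by (intro card_Un_disjoint) auto
  moreover have "card (A \<union> ?P) \<le> card ?L"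
  proof (rule card_mono, goal_cases)
    case 1
    then show ?case using finite_punctured_sums[OF fin] by simp
  next
    case 2
    have "s + 3 * a \<in> ?L" if s: "s \<in> pair_sums (z - a) B" for s
    proof -
      obtain x y where xy: "x \<in> B" "y \<in> B" "x \<noteq> y" "s = x + 2 * y" "s < 2 * (z - a)"
        using s by (auto simp: pair_sums_def)
      have "(a + x) + 2 * (a + y) \<in> punctured_sums A"
        by (rule punctured_sums_pair) (use xy AB in auto)
      then show ?thesis using xy by (simp add: algebra_simps)
    qed
    moreover have "x \<in> ?L" if "x \<in> A" for x
      using that sub a az punctured_sums_single[OF that] by force
    ultimately show ?case by blast
  qed
  ultimately show ?thesis by simp
qed

section \<open>Three-term progressions and the exceptional triple\<close>

lemma card_ge_of_distinct_list:
  "finite S \<Longrightarrow> distinct xs \<Longrightarrow> set xs \<subseteq> S \<Longrightarrow> length xs \<le> card S"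
  by (metis card_mono distinct_card)

text \<open>The window supplies only \<open>3 * a + 2 * g\<close>. The fifth value
  \<open>3 * a + g\<close> lies below it and meets an element of \<open>A\<close> exactly when
  \<open>g = 2 * a\<close>.\<close>

lemma card_low_punctured_sums_AP:
  assumes a: "0 < a" and g: "0 < g" and ne: "g \<noteq> 2 * a" and A: "A = {a, a + g, a + 2 * g}"
  shows "5 \<le> card {x \<in> punctured_sums A. x < 2 * (a + 2 * g) + a}" (is "_ \<le> card ?L")
proof -
  have "length [a, a + g, a + 2 * g, 3 * a + g, 3 * a + 2 * g] \<le> card ?L"
  proof (rule card_ge_of_distinct_list)
    show "finite ?L" using finite_punctured_sums[of A] A by simp
    show "distinct [a, a + g, a + 2 * g, 3 * a + g, 3 * a + 2 * g]" using assms by auto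
    have "a \<in> punctured_sums A" "a + g \<in> punctured_sums A" "a + 2 * g \<in> punctured_sums A"
      by (rule punctured_sums_single, simp add: A)+
    moreover have "(a + g) + 2 * a \<in> punctured_sums A" "(a + 2 * g) + 2 * a \<in> punctured_sums A"
      by (rule punctured_sums_pair; use A g in simp)+
    ultimately show "set [a, a + g, a + 2 * g, 3 * a + g, 3 * a + 2 * g] \<subseteq> ?L"
      using a g by (auto simp: algebra_simps)
  qed
  then show ?thesis by simp
qed

text \<open>The triple has one sum too few, as \<open>9 * a\<close> is missing, so the new element
  must contribute eight low sums instead of seven.\<close>

lemma card_punctured_sums_exceptional:
  assumes a: "0 < a" and z: "5 * a < z"
  shows "16 \<le> card (punctured_sums (insert z {a, 3 * a, 5 * a}))"
proof -
  let ?B = "{a, 3 * a, 5 * a}" and ?A = "insert z {a, 3 * a, 5 * a}"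
  let ?L = "{x \<in> punctured_sums ?A. x < 2 * z + a}"
  have finA: "finite (punctured_sums ?A)" by (rule finite_punctured_sums) simp
  have pB: "a \<in> punctured_sums ?B" "3 * a \<in> punctured_sums ?B" "5 * a \<in> punctured_sums ?B"
      "5 * a + 2 * a \<in> punctured_sums ?B" "a + 2 * (5 * a) \<in> punctured_sums ?B"
      "3 * a + 2 * (5 * a) \<in> punctured_sums ?B"
      "5 * a + 2 * (a + 3 * a) \<in> punctured_sums ?B" "3 * a + 2 * (a + 5 * a) \<in> punctured_sums ?B"
      "a + 2 * (3 * a + 5 * a) \<in> punctured_sums ?B"
    by ((rule punctured_sums_single punctured_sums_pair punctured_sums_triple; use a in simp)+)
  have pA: "z \<in> punctured_sums ?A" "z + 2 * a \<in> punctured_sums ?A" "z + 2 * (3 * a) \<in> punctured_sums ?A"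
      "z + 2 * (a + 3 * a) \<in> punctured_sums ?A"
    by ((rule punctured_sums_single punctured_sums_pair punctured_sums_triple; use a z in simp)+)
  have BA: "punctured_sums ?B \<subseteq> punctured_sums ?A" by (rule punctured_sums_mono) auto
  show ?thesis
  proof (cases "z = 7 * a")
    case True
    \<comment> \<open>All sums are odd multiples of \<open>a\<close>, so only seven can lie below
      \<open>2 * z + a = 15 * a\<close> and the increment argument is too weak. All 16 values are
      exhibited, the upper half by reflection.\<close>
    let ?xs = "map (\<lambda>k. k * a) [1,3,5,7,9,11,13,15,17,19,21,23,25,27,29,31]"
    have refl: "32 * a - x \<in> punctured_sums ?A" if "x \<in> punctured_sums ?A" for x
    proof -
      have "\<Sum>?A = 16 * a" using True a by simp
      then show ?thesis using punctured_sums_reflect[OF _ that] by simp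
    qed
    have half: "a \<in> punctured_sums ?A" "3 * a \<in> punctured_sums ?A" "5 * a \<in> punctured_sums ?A"
      "7 * a \<in> punctured_sums ?A" "9 * a \<in> punctured_sums ?A" "11 * a \<in> punctured_sums ?A"
      "13 * a \<in> punctured_sums ?A" "15 * a \<in> punctured_sums ?A"
      using pB pA BA True by (auto simp: algebra_simps)
    have "length ?xs \<le> card (punctured_sums ?A)"
    proof (rule card_ge_of_distinct_list[OF finA])
      show "distinct ?xs" using a by simp
      show "set ?xs \<subseteq> punctured_sums ?A" using half refl[OF half(1)] refl[OF half(2)] refl[OF half(3)]
          refl[OF half(4)] refl[OF half(5)] refl[OF half(6)] refl[OF half(7)] refl[OF half(8)] by simp
    qed
    then show ?thesis by simp
  next
    case False
    have "8 \<le> card (punctured_sums ?B)"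
    proof -
      let ?xs = "map (\<lambda>k. k * a) [1,3,5,7,11,13,15,17]"
      have "length ?xs \<le> card (punctured_sums ?B)"
        by (rule card_ge_of_distinct_list) (use a pB in \<open>auto intro: finite_punctured_sums\<close>)
      then show ?thesis by simp
    qed
    moreover have "8 \<le> card ?L"
    proof (cases "z < 7 * a")
      case True
      let ?xs = "[a, 3 * a, 5 * a, 7 * a, 11 * a, z, z + 2 * a, z + 6 * a]"
      have "length ?xs \<le> card ?L"
        by (rule card_ge_of_distinct_list) (use a z True finA pA pB BA in auto)
      then show ?thesis by simp
    next
      case F2: False
      \<comment> \<open>For larger \<open>z\<close> the value \<open>11 * a\<close> may coincide
        with \<open>z\<close> or \<open>z + 2 * a\<close>; \<open>z + 8 * a\<close> replaces it and
        is low because \<open>7 * a < z\<close>.\<close>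
      let ?xs = "[a, 3 * a, 5 * a, 7 * a, z, z + 2 * a, z + 6 * a, z + 8 * a]"
      have "length ?xs \<le> card ?L"
        by (rule card_ge_of_distinct_list) (use a z False F2 finA pA pB BA in auto)
      then show ?thesis by simp
    qed
    moreover have "card (punctured_sums ?B) + card ?L \<le> card (punctured_sums ?A)"
      by (rule card_punctured_sums_insert_max) (use a z in auto)
    ultimately show ?thesis by simp
  qed
qed

section \<open>Induction on the largest element\<close>

lemma card_punctured_sums_ge:
  assumes "finite A" and "\<forall>x\<in>A. 0 < x"
  shows "(card A)\<^sup>2 \<le> card (punctured_sums A) \<or> (\<exists>a>0. A = {a, 3 * a, 5 * a})"
  using assms
proof (induction A rule: finite_linorder_max_induct)
  case empty
  then show ?case by simp
next
  case (insert z A)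
  let ?A = "insert z A"
  have zA: "z \<notin> A" using insert.hyps by blast
  consider "A = {}" | a where "0 < a" "A = {a, 3 * a, 5 * a}"
    | "A \<noteq> {}" "(card A)\<^sup>2 \<le> card (punctured_sums A)"
    using insert by auto
  then show ?case
  proof cases
    case 1
    then have "punctured_sums ?A \<noteq> {}" using punctured_sums_single[of z "{z}"] by auto
    then have "0 < card (punctured_sums ?A)" using finite_punctured_sums[of ?A] 1 by (simp add: card_gt_0_iff)
    then show ?thesis using 1 by simp
  next
    case 2
    then have "(card ?A)\<^sup>2 = 16" using zA by (simp add: power2_eq_square)
    moreover have "16 \<le> card (punctured_sums ?A)"
      using card_punctured_sums_exceptional[of a z] 2 insert.hyps by simp
    ultimately show ?thesis by linarith
  next
    case 3
    define a where "a = Min A"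
    have aA: "a \<in> A" and min: "\<And>y. y \<in> A \<Longrightarrow> a \<le> y" using 3 insert.hyps by (auto simp: a_def)
    have a0: "0 < a" and az: "a < z" using aA insert by auto
    let ?L = "{x \<in> punctured_sums ?A. x < 2 * z + a}"
    have step: "card (punctured_sums A) + card ?L \<le> card (punctured_sums ?A)"
      by (rule card_punctured_sums_insert_max) (use insert min a0 in auto)
    have fin: "2 * card ?A \<le> card ?L + 1 \<Longrightarrow> (card ?A)\<^sup>2 \<le> card (punctured_sums ?A)"
      using step 3(2) zA insert.hyps by (simp add: power2_eq_square)
    show ?thesis
    proof (cases "\<exists>g. ?A = {a, a + g, a + 2 * g}")
      case False
      have "2 * card ?A \<le> card ?L + 1"
      proof (rule card_low_punctured_sums)
        show "?A \<subseteq> {a..z}" using min insert.hyps(2) az by (auto intro: less_imp_le)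
      qed (use insert.hyps(1) aA a0 az False in auto)
      then show ?thesis using fin by blast
    next
      case True
      then obtain g where g: "?A = {a, a + g, a + 2 * g}" by blast
      \<comment> \<open>As \<open>a\<close> is the minimum and \<open>z\<close> the maximum, the
        progression must be increasing and end in \<open>z\<close>.\<close>
      have sub: "a + g \<in> ?A" "a + 2 * g \<in> ?A" "z \<in> {a, a + g, a + 2 * g}" using g by auto
      have "0 \<le> g" using sub(1) min[of "a + g"] az by auto
      moreover have "g \<noteq> 0" using sub(3) az by auto
      ultimately have g0: "0 < g" by simp
      have "a + 2 * g \<le> z" using sub(2) insert.hyps(2) by (auto intro: less_imp_le)
      then have zg: "z = a + 2 * g" "0 < g" using sub(3) az g0 by auto
      show ?thesis
      proof (cases "g = 2 * a")
        case True
        then have "?A = {a, 3 * a, 5 * a}" using g by (simp add: algebra_simps)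
        then show ?thesis using a0 by blast
      next
        case False
        have "5 \<le> card ?L" using card_low_punctured_sums_AP[OF a0 zg(2) False g] zg by simp
        moreover have "card ?A = 3" using g zg(2) by simp
        ultimately show ?thesis using fin by simp
      qed
    qed
  qed
qed

section \<open>Transfer to signed sumsets\<close>

lemma card_punctured_sums_le_signed:
  assumes fin: "finite A" and card: "card A = h + 1"
  shows "card (punctured_sums A) \<le> card (restricted_signed_sumset h A)"
proof (rule card_inj_on_le[of "\<lambda>x. x - \<Sum>A"])
  show "inj_on (\<lambda>x. x - \<Sum>A) (punctured_sums A)" by (simp add: inj_on_def)
  \<comment> \<open>Finiteness has to be shown, since \<open>card\<close> is 0 on infinite sets;
    restricting \<open>l\<close> to \<open>A\<close> leaves finitely many coefficient
    functions.\<close>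
  have "restricted_signed_sumset h A
    \<subseteq> (\<lambda>l. \<Sum>a\<in>A. l a * a) ` (A \<rightarrow>\<^sub>E {-1, 0, 1})"
  proof
    fix s assume "s \<in> restricted_signed_sumset h A"
    then obtain l where l: "s = (\<Sum>a\<in>A. l a * a)" "\<forall>a\<in>A. l a \<in> {-1, 0, 1}"
      unfolding restricted_signed_sumset_def by blast
    show "s \<in> (\<lambda>l. \<Sum>a\<in>A. l a * a) ` (A \<rightarrow>\<^sub>E {-1, 0, 1})"
    proof (rule image_eqI[of _ _ "restrict l A"])
      show "s = (\<Sum>a\<in>A. restrict l A a * a)" using l by simp
      show "restrict l A \<in> A \<rightarrow>\<^sub>E {-1, 0, 1}" using l by (simp add: restrict_PiE_iff)
    qed
  qed
  then show "finite (restricted_signed_sumset h A)"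
    by (rule finite_subset) (use fin in \<open>auto intro!: finite_PiE\<close>)
  show "(\<lambda>x. x - \<Sum>A) ` punctured_sums A \<subseteq> restricted_signed_sumset h A"
  proof
    fix s assume "s \<in> (\<lambda>x. x - \<Sum>A) ` punctured_sums A"
    then obtain i T where i: "i \<in> A" "T \<subseteq> A - {i}" "s = i + 2 * \<Sum>T - \<Sum>A"
      by (auto simp: punctured_sums_def)
    define l :: "int \<Rightarrow> int" where "l = (\<lambda>a. if a = i then 0 else if a \<in> T then 1 else -1)"
    \<comment> \<open>This writes the coefficients 0, 1, -1 as two indicators minus 1; it relies on
      \<open>i\<close> lying outside \<open>T\<close>.\<close>
    have la: "l a * a = (if a = i then i else 0) + 2 * (if a \<in> T then a else 0) - a" for a
      using i by (auto simp: l_def)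
    have "(\<Sum>a\<in>A. l a * a) = i + 2 * (\<Sum>a\<in>A. if a \<in> T then a else 0) - \<Sum>A"
      unfolding la using fin i(1)
      by (simp add: sum.distrib sum_subtractf sum_distrib_left[symmetric])
    also have "(\<Sum>a\<in>A. if a \<in> T then a else 0) = \<Sum>(A \<inter> T)"
      using fin by (simp add: sum.inter_restrict)
    also have "A \<inter> T = T" using i by auto
    finally have s: "s = (\<Sum>a\<in>A. l a * a)" using i by simp
    have "(\<Sum>a\<in>A. \<bar>l a\<bar>) = (\<Sum>a\<in>A - {i}. 1)"
    proof -
      have "(\<Sum>a\<in>A. \<bar>l a\<bar>) = (\<Sum>a\<in>A - {i}. \<bar>l a\<bar>)"
        using fin i(1) by (subst sum.remove[of _ i]) (auto simp: l_def)
      also have "\<dots> = (\<Sum>a\<in>A - {i}. 1)" by (rule sum.cong) (auto simp: l_def)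
      finally show ?thesis .
    qed
    also have "\<dots> = int h" using fin i card by simp
    finally have "(\<Sum>a\<in>A. \<bar>l a\<bar>) = int h" .
    moreover have "\<forall>a\<in>A. l a \<in> {-1, 0, 1}" by (simp add: l_def)
    ultimately show "s \<in> restricted_signed_sumset h A"
      unfolding restricted_signed_sumset_def using s by blast
  qed
qed

section \<open>Sharpness for the first odd numbers\<close>

text \<open>The elements sum to \<open>(h + 1)^2\<close> and one of them, at least 1, is omitted, so
  each signed sum has absolute value at most \<open>?m\<close>. All signed sums have the parity of
  \<open>h\<close>, hence of \<open>?m\<close>, leaving \<open>?m + 1\<close> values.\<close>

lemma card_signed_odds_le:
  fixes h :: nat
  defines "A \<equiv> (\<lambda>k. 2 * int k + 1) ` {..h}"
  shows "card (restricted_signed_sumset h A) \<le> h\<^sup>2 + 2 * h + 1"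
proof -
  let ?m = "int (h\<^sup>2 + 2 * h)"
  let ?f = "\<lambda>k. 2 * k - ?m"
  have inj: "inj_on (\<lambda>k. 2 * int k + 1) S" for S by (simp add: inj_on_def)
  have finA: "finite A" by (simp add: A_def)
  have cA: "card A = h + 1" using card_image[OF inj, of "{..h}"] by (simp add: A_def)
  have "(\<Sum>k\<le>h. 2 * int k + 1) = (int h + 1)\<^sup>2"
    by (induction h) (auto simp: power2_eq_square algebra_simps)
  then have sumA: "\<Sum>A = ?m + 1"
    unfolding A_def by (subst sum.reindex[OF inj]) (simp add: power2_eq_square algebra_simps)
  have pos: "1 \<le> x" "odd x" if "x \<in> A" for x using that by (auto simp: A_def)
  have "restricted_signed_sumset h A \<subseteq> ?f ` {0..?m}"
  proof
    fix s assume "s \<in> restricted_signed_sumset h A"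
    then obtain l where l: "s = (\<Sum>a\<in>A. l a * a)" "\<And>a. a \<in> A \<Longrightarrow> l a \<in> {-1, 0, 1}"
      "(\<Sum>a\<in>A. \<bar>l a\<bar>) = int h"
      unfolding restricted_signed_sumset_def by blast
    have "\<exists>i\<in>A. l i = 0"
    proof (rule ccontr)
      assume "\<not> ?thesis"
      then have "\<bar>l a\<bar> = 1" if "a \<in> A" for a using l(2)[OF that] that by auto
      then have "(\<Sum>a\<in>A. \<bar>l a\<bar>) = int h + 1" using cA by simp
      then show False using l by simp
    qed
    then obtain i where i: "i \<in> A" "l i = 0" by blast
    have "\<bar>s\<bar> \<le> (\<Sum>a\<in>A. \<bar>l a * a\<bar>)" unfolding l(1) by (rule sum_abs)
    also have "\<dots> = (\<Sum>a\<in>A - {i}. \<bar>l a * a\<bar>)" using finA i by (subst sum.remove[of _ i]) auto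
    also have "\<dots> \<le> \<Sum>(A - {i})" using l(2) pos by (intro sum_mono) force
    also have "\<dots> = ?m + 1 - i" using finA i sumA by (simp add: sum_diff1)
    finally have bound: "\<bar>s\<bar> \<le> ?m" using pos[OF i(1)] by simp
    \<comment> \<open>For odd \<open>a\<close>, \<open>l a * a\<close> and
      \<open>\<bar>l a\<bar>\<close> have the same parity.\<close>
    have "even (s - (\<Sum>a\<in>A. \<bar>l a\<bar>))"
      unfolding l(1) sum_subtractf[symmetric]
      by (rule dvd_sum) (use l(2) pos in force)
    then have "even (s - int h)" using l by simp
    moreover have "even (int h + ?m)" by simp
    ultimately have "even (s + ?m)" by presburger
    then obtain k where "s + ?m = 2 * k" by (rule evenE)
    then show "s \<in> ?f ` {0..?m}" using bound by (intro image_eqI[of _ _ k]) auto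
  qed
  then have "card (restricted_signed_sumset h A) \<le> card {0..?m}"
    by (rule surj_card_le[rotated]) simp
  also have "card {0..?m} = h\<^sup>2 + 2 * h + 1" by (simp only: card_atLeastAtMost_int)
  finally show ?thesis .
qed

theorem theorem5:
  fixes h :: nat
  assumes "h \<ge> 3"
  shows "(\<forall>A :: int set. finite A \<and> card A = h + 1 \<and> (\<forall>a\<in>A. 0 < a) \<longrightarrow>
            card (restricted_signed_sumset h A) \<ge> h\<^sup>2 + 2 * h + 1) \<and>
         (\<exists>A :: int set. finite A \<and> card A = h + 1 \<and> (\<forall>a\<in>A. 0 < a) \<and>
            card (restricted_signed_sumset h A) = h\<^sup>2 + 2 * h + 1)"
proof
  have sq: "h\<^sup>2 + 2 * h + 1 = (h + 1)\<^sup>2" by (simp add: power2_eq_square)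
  show lower: "\<forall>A :: int set. finite A \<and> card A = h + 1 \<and> (\<forall>a\<in>A. 0 < a) \<longrightarrow>
            card (restricted_signed_sumset h A) \<ge> h\<^sup>2 + 2 * h + 1"
  proof (intro allI impI)
    fix A :: "int set" assume A: "finite A \<and> card A = h + 1 \<and> (\<forall>a\<in>A. 0 < a)"
    \<comment> \<open>Here \<open>h \<ge> 3\<close> enters: \<open>A\<close> has at least four
      elements.\<close>
    have "A \<noteq> {a, 3 * a, 5 * a}" if "a > 0" for a
      using A assms that by auto
    then have "(card A)\<^sup>2 \<le> card (punctured_sums A)" using card_punctured_sums_ge[of A] A by blast
    then show "h\<^sup>2 + 2 * h + 1 \<le> card (restricted_signed_sumset h A)"
      using card_punctured_sums_le_signed[of A h] A sq by simp
  qed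
  let ?A = "(\<lambda>k. 2 * int k + 1) ` {..h}"
  have "inj_on (\<lambda>k. 2 * int k + 1) {..h}" by (simp add: inj_on_def)
  then have A: "finite ?A \<and> card ?A = h + 1 \<and> (\<forall>a\<in>?A. 0 < a)" by (auto simp: card_image)
  then have "h\<^sup>2 + 2 * h + 1 \<le> card (restricted_signed_sumset h ?A)" using lower by blast
  then have "card (restricted_signed_sumset h ?A) = h\<^sup>2 + 2 * h + 1"
    using card_signed_odds_le[of h] by (rule antisym[rotated])
  with A show "\<exists>A :: int set. finite A \<and> card A = h + 1 \<and> (\<forall>a\<in>A. 0 < a) \<and>
            card (restricted_signed_sumset h A) = h\<^sup>2 + 2 * h + 1" by blast
qed

end
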